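(* Suppose $f\colon\mathbb{N}\to[0,\infty)$ is a sub-identical order function such that $\sum_{m=0}^\infty f(2^m)/2^m$ converges to a recursive real. Then there is an order function $g\colon\mathbb{N}\to[0,\infty)$ such that $\mathrm{SC}(f) \leq_{\mathrm{s}} \mathrm{COMPLEX}(g)$ and $\lim_{n \to \infty} g(n)/n=0$.
   Context: An order function is a computable (i.e. its values are uniformly computable reals), nondecreasing, unbounded function $\mathbb{N}\to\mathbb{R}$. A function $f\colon\mathbb{N}\to[0,\infty)$ is sub-identical if $\lim_{n\to\infty}(n-f(n))=\infty$. A real is recursive if it is computable. Prefix-free complexity: a prefix-free machine is a partial recursive $M$ from $\{0,1\}^*$ to $\{0,1\}^*$ with prefix-free domain; $U$ is universal if for each prefix-free machine $M$ there is $\rho$ with $U(\rho^\frown\tau)\simeq M(\tau)$ for all $\tau$. Fix a universal $U$ and let $K(\sigma)=\min\{|\tau| : U(\tau)=\sigma\}$. For $f\colon\mathbb{N}\to\mathbb{R}$, $\mathrm{COMPLEX}(f)$ is the set of $X\in\{0,1\}^{\mathbb{N}}$ for which there is $c\in\mathbb{N}$ with $K(X\upharpoonright n)\geq f(n)-c$ for all $n$; $\mathrm{SC}(f)$ is the set of $X\in\{0,1\}^{\mathbb{N}}$ for which there is $c\in\mathbb{N}$ with $K(\tau)\geq f(|\tau|)-c$ for every (contiguous, finite) substring $\tau$ of $X$. For $P,Q\subseteq\mathbb{N}^{\mathbb{N}}$, $P\leq_{\mathrm{s}}Q$ means there is a partial recursive functional defined on all of $Q$ that maps $Q$ into $P$.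 *)

theory Defs
  imports Complex_Main "HOL-Library.Nat_Bijection" "HOL-Library.Sublist"
begin

text \<open>
  Programs for partial recursive functions relative to a point \<open>X\<close> of Baire space (consulted
  by \<open>Query\<close>). Functions are unary; further arguments are passed through the Cantor pairing
  function \<^const>\<open>prod_encode\<close>.
\<close>

datatype prog =
    Zero | Succ | Fst | Snd | Query
  | Tuple prog prog | Comp prog prog | Rec prog prog | Mu prog

definition minimize :: "(nat \<Rightarrow> nat option) \<Rightarrow> nat option" where
  "minimize \<phi> =
     (if \<exists>k. \<phi> k = Some 0 \<and> (\<forall>j<k. \<phi> j \<noteq> None) then Some (LEAST k. \<phi> k = Some 0) else None)"

primrec run :: "(nat \<Rightarrow> nat) \<Rightarrow> prog \<Rightarrow> nat \<Rightarrow> nat option" where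
  "run X Zero = (\<lambda>n. Some 0)"
| "run X Succ = (\<lambda>n. Some (Suc n))"
| "run X Fst = (\<lambda>n. Some (fst (prod_decode n)))"
| "run X Snd = (\<lambda>n. Some (snd (prod_decode n)))"
| "run X Query = (\<lambda>n. Some (X n))"
| "run X (Tuple p q) =
     (\<lambda>n. Option.bind (run X p n) (\<lambda>a. Option.bind (run X q n) (\<lambda>b. Some (prod_encode (a, b)))))"
| "run X (Comp p q) = (\<lambda>n. Option.bind (run X q n) (run X p))"
| "run X (Rec p q) =
     (\<lambda>n. case prod_decode n of (a, m) \<Rightarrow>
        rec_nat (run X p a)
          (\<lambda>k r. Option.bind r (\<lambda>b. run X q (prod_encode (a, prod_encode (k, b))))) m)"
| "run X (Mu p) = (\<lambda>n. minimize (\<lambda>k. run X p (prod_encode (n, k))))"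

primrec query_free :: "prog \<Rightarrow> bool" where
  "query_free Zero = True"
| "query_free Succ = True"
| "query_free Fst = True"
| "query_free Snd = True"
| "query_free Query = False"
| "query_free (Tuple p q) = (query_free p \<and> query_free q)"
| "query_free (Comp p q) = (query_free p \<and> query_free q)"
| "query_free (Rec p q) = (query_free p \<and> query_free q)"
| "query_free (Mu p) = query_free p"

text \<open>The choice of the point \<open>\<lambda>_. 0\<close> is immaterial, since the program makes no queries.\<close>

definition partial_recursive :: "(nat \<Rightarrow> nat option) \<Rightarrow> bool" where
  "partial_recursive \<phi> \<longleftrightarrow> (\<exists>p. query_free p \<and> \<phi> = run (\<lambda>_. 0) p)"

definition recursive :: "(nat \<Rightarrow> nat) \<Rightarrow> bool" where
  "recursive h \<longleftrightarrow> partial_recursive (\<lambda>n. Some (h n))"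

text \<open>
  A partial functional \<open>\<Psi>\<close> on Baire space is represented by the partial functions \<open>\<Psi> X\<close>;
  it is defined at \<open>X\<close> iff \<open>\<Psi> X\<close> is total.
\<close>

definition partial_recursive_functional :: "((nat \<Rightarrow> nat) \<Rightarrow> nat \<Rightarrow> nat option) \<Rightarrow> bool" where
  "partial_recursive_functional \<Psi> \<longleftrightarrow> (\<exists>p. \<forall>X. \<Psi> X = run X p)"

definition strongly_reducible :: "(nat \<Rightarrow> nat) set \<Rightarrow> (nat \<Rightarrow> nat) set \<Rightarrow> bool"
    (infix "\<le>\<^sub>s" 50) where
  "P \<le>\<^sub>s Q \<longleftrightarrow>
     (\<exists>\<Psi>. partial_recursive_functional \<Psi> \<and> (\<forall>X\<in>Q. \<exists>Y\<in>P. \<forall>n. \<Psi> X n = Some (Y n)))"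

text \<open>A code \<open>(i, d)\<close> stands for the rational \<open>z / (d + 1)\<close>, where \<open>i\<close> codes the integer \<open>z\<close>.\<close>

definition decode_rat :: "nat \<Rightarrow> real" where
  "decode_rat m = (case prod_decode m of (i, d) \<Rightarrow> of_int (int_decode i) / of_nat (Suc d))"

definition computable_real :: "real \<Rightarrow> bool" where
  "computable_real x \<longleftrightarrow> (\<exists>h. recursive h \<and> (\<forall>k. \<bar>x - decode_rat (h k)\<bar> \<le> 1 / 2 ^ k))"

definition computable_real_function :: "(nat \<Rightarrow> real) \<Rightarrow> bool" where
  "computable_real_function f \<longleftrightarrow>
     (\<exists>h. recursive h \<and> (\<forall>n k. \<bar>f n - decode_rat (h (prod_encode (n, k)))\<bar> \<le> 1 / 2 ^ k))"

definition order_function :: "(nat \<Rightarrow> real) \<Rightarrow> bool" where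
  "order_function f \<longleftrightarrow> computable_real_function f \<and> mono f \<and> \<not> bdd_above (range f)"

definition sub_identical :: "(nat \<Rightarrow> real) \<Rightarrow> bool" where
  "sub_identical f \<longleftrightarrow> (\<forall>n. 0 \<le> f n) \<and> filterlim (\<lambda>n. real n - f n) at_top sequentially"

definition encode_string :: "bool list \<Rightarrow> nat" where
  "encode_string \<sigma> = list_encode (map of_bool \<sigma>)"

definition prefix_free_machine :: "(bool list \<Rightarrow> bool list option) \<Rightarrow> bool" where
  "prefix_free_machine M \<longleftrightarrow>
     (\<exists>\<phi>. partial_recursive \<phi> \<and> (\<forall>\<sigma>. \<phi> (encode_string \<sigma>) = map_option encode_string (M \<sigma>))) \<and>
     (\<forall>\<sigma>\<in>dom M. \<forall>\<tau>\<in>dom M. prefix \<sigma> \<tau> \<longrightarrow> \<sigma> = \<tau>)"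

definition universal_machine :: "(bool list \<Rightarrow> bool list option) \<Rightarrow> bool" where
  "universal_machine U \<longleftrightarrow>
     prefix_free_machine U \<and>
     (\<forall>M. prefix_free_machine M \<longrightarrow> (\<exists>\<rho>. \<forall>\<tau>. U (\<rho> @ \<tau>) = M \<tau>))"

text \<open>For universal \<open>U\<close> every string has a description, so the minimum below exists.\<close>

definition K :: "(bool list \<Rightarrow> bool list option) \<Rightarrow> bool list \<Rightarrow> nat" where
  "K U \<sigma> = (LEAST k. \<exists>\<tau>. U \<tau> = Some \<sigma> \<and> k = length \<tau>)"

definition substring :: "bool list \<Rightarrow> (nat \<Rightarrow> bool) \<Rightarrow> bool" where
  "substring \<tau> X \<longleftrightarrow> (\<exists>i. \<tau> = map X [i..<i + length \<tau>])"

definition COMPLEX :: "(bool list \<Rightarrow> bool list option) \<Rightarrow> (nat \<Rightarrow> real) \<Rightarrow> (nat \<Rightarrow> bool) set" where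
  "COMPLEX U f = {X. \<exists>c::nat. \<forall>n. real (K U (map X [0..<n])) \<ge> f n - real c}"

definition SC :: "(bool list \<Rightarrow> bool list option) \<Rightarrow> (nat \<Rightarrow> real) \<Rightarrow> (nat \<Rightarrow> bool) set" where
  "SC U f =
     {X. \<exists>c::nat. \<forall>\<tau>. substring \<tau> X \<longrightarrow> real (K U \<tau>) \<ge> f (length \<tau>) - real c}"

text \<open>The inclusion of Cantor space in Baire space, with \<open>True\<close> as 1 and \<open>False\<close> as 0.\<close>

definition to_baire :: "(nat \<Rightarrow> bool) \<Rightarrow> nat \<Rightarrow> nat" where
  "to_baire X = (\<lambda>n. of_bool (X n))"

end

theory Submission
  imports Defs
begin

text \<open>
  A point of \<open>SC U f\<close> is obtained from \<open>X \<in> COMPLEX U g\<close> by a Toeplitz construction: the bits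
  \<open>X 0, \<dots>, X (F m - 1)\<close> are copied to pairwise disjoint residue classes modulo \<open>2 ^ m\<close>, for every
  \<open>m\<close>, which is possible when \<open>\<Sum>m. F m / 2 ^ m \<le> 1\<close>. A window of length \<open>2 ^ (m + 1)\<close>, together
  with its starting position modulo \<open>2 ^ m\<close>, then determines the first \<open>F m\<close> bits of \<open>X\<close>, so its
  complexity is at least \<open>g (F m) - 2 * m - O(1)\<close>. It remains to find \<open>F\<close> and \<open>g\<close> with
  \<open>g (F m) \<ge> f (2 ^ (m + 2)) + 2 * m\<close> and \<open>g n = o(n)\<close>. Since \<open>\<Sum>m. f (2 ^ m) / 2 ^ m\<close> has a
  computable sum, its tails have a computable modulus, and therefore \<open>F m\<close> can exceed
  \<open>f (2 ^ (m + 2)) + 2 * m\<close> by an unbounded computable factor without violating the bound on the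
  sum.
\<close>

section \<open>Closure properties of the recursive functions\<close>

abbreviation arg1 :: "nat \<Rightarrow> nat" where "arg1 x \<equiv> fst (prod_decode x)"
abbreviation arg2 :: "nat \<Rightarrow> nat" where "arg2 x \<equiv> snd (prod_decode x)"

definition recursive2 :: "(nat \<Rightarrow> nat \<Rightarrow> nat) \<Rightarrow> bool" where
  "recursive2 h \<longleftrightarrow> recursive (\<lambda>x. h (arg1 x) (arg2 x))"

lemma run_query_free: "query_free p \<Longrightarrow> run X p = run Y p"
proof (induction p)
  case (Rec p q)
  then have "run X p = run Y p" "run X q = run Y q" by auto
  then show ?case by simp
qed simp_all

lemma recursiveI:
  assumes "query_free p" and "\<And>n. run (\<lambda>_. 0) p n = Some (h n)"
  shows "recursive h"
  using assms unfolding recursive_def partial_recursive_def by (metis ext)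

lemma recursiveE:
  assumes "recursive h"
  obtains p where "query_free p" and "\<And>X n. run X p n = Some (h n)"
  using assms unfolding recursive_def partial_recursive_def by (metis run_query_free)

lemma partial_recursiveE:
  assumes "partial_recursive \<phi>"
  obtains p where "query_free p" and "\<And>X n. run X p n = \<phi> n"
  using assms unfolding partial_recursive_def by (metis run_query_free)

text \<open>Cantor pairing is a bijection, so pairing both projections returns the argument;
  \<open>Tuple Fst Snd\<close> serves as the identity program below.\<close>

lemma recursive_id: "recursive (\<lambda>x. x)"
  by (rule recursiveI[of "Tuple Fst Snd"]) auto

lemma recursive_comp:
  assumes "recursive h" and "recursive a"
  shows "recursive (\<lambda>x. h (a x))"
proof -
  obtain p q where "query_free p" "\<And>X n. run X p n = Some (h n)"
    "query_free q" "\<And>X n. run X q n = Some (a n)"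
    using assms by (meson recursiveE)
  then show ?thesis by (intro recursiveI[of "Comp p q"]) auto
qed

lemma recursive_Suc: "recursive a \<Longrightarrow> recursive (\<lambda>x. Suc (a x))"
  by (rule recursive_comp[of Suc]) (auto intro: recursiveI[of Succ])

lemma recursive_arg1: "recursive a \<Longrightarrow> recursive (\<lambda>x. arg1 (a x))"
  by (rule recursive_comp[of arg1]) (auto intro: recursiveI[of Fst])

lemma recursive_arg2: "recursive a \<Longrightarrow> recursive (\<lambda>x. arg2 (a x))"
  by (rule recursive_comp[of arg2]) (auto intro: recursiveI[of Snd])

lemma recursive_const: "recursive (\<lambda>_. c)"
proof (induction c)
  case 0
  show ?case by (rule recursiveI[of Zero]) auto
qed (rule recursive_Suc)

lemma recursive_prod_encode:
  assumes "recursive a" and "recursive b"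
  shows "recursive (\<lambda>x. prod_encode (a x, b x))"
proof -
  obtain p q where "query_free p" "\<And>X n. run X p n = Some (a n)"
    "query_free q" "\<And>X n. run X q n = Some (b n)"
    using assms by (meson recursiveE)
  then show ?thesis by (intro recursiveI[of "Tuple p q"]) auto
qed

lemma recursive_comp2:
  assumes "recursive2 h" and "recursive a" and "recursive b"
  shows "recursive (\<lambda>x. h (a x) (b x))"
  using recursive_comp[OF assms(1)[unfolded recursive2_def] recursive_prod_encode[OF assms(2,3)]]
  by simp

text \<open>\<open>Rec\<close> hands its first argument unchanged to every step. Taking the whole
  input \<open>x\<close> as that argument lets the step \<open>c\<close> depend on
  \<open>x\<close>.\<close>

lemma recursive_rec_nat:
  assumes a: "recursive a" and n: "recursive n"
    and c: "recursive (\<lambda>y. c (arg1 y) (arg1 (arg2 y)) (arg2 (arg2 y)))"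
  shows "recursive (\<lambda>x. rec_nat (a x) (c x) (n x))"
proof -
  obtain p q r where p: "query_free p" "\<And>X n. run X p n = Some (a n)"
    and q: "query_free q"
      "\<And>X y. run X q y = Some (c (arg1 y) (arg1 (arg2 y)) (arg2 (arg2 y)))"
    and r: "query_free r" "\<And>X x. run X r x = Some (n x)"
    using assms by (meson recursiveE)
  have "rec_nat (Some (a x)) (\<lambda>k r. Option.bind r (\<lambda>b. Some (c x k b))) m
      = Some (rec_nat (a x) (c x) m)" for x m
    by (induction m) auto
  with p q r show ?thesis
    by (intro recursiveI[of "Comp (Rec p q) (Tuple (Tuple Fst Snd) r)"]) auto
qed

lemma recursive_add:
  assumes "recursive a" and "recursive b"
  shows "recursive (\<lambda>x. a x + b x)"
proof -
  have "rec_nat m (\<lambda>k. Suc) n = m + n" for m n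
    by (induction n) auto
  moreover have "recursive (\<lambda>x. rec_nat (a x) (\<lambda>k. Suc) (b x))"
    by (intro recursive_rec_nat recursive_Suc recursive_arg2 recursive_id assms)
  ultimately show ?thesis by simp
qed

lemma recursive_mult:
  assumes "recursive a" and "recursive b"
  shows "recursive (\<lambda>x. a x * b x)"
proof -
  have "rec_nat 0 (\<lambda>k r. m + r) n = m * n" for m n :: nat
    by (induction n) auto
  moreover have "recursive (\<lambda>x. rec_nat 0 (\<lambda>k r. a x + r) (b x))"
    by (intro recursive_rec_nat recursive_add recursive_comp[OF assms(1)] recursive_const
        recursive_arg1 recursive_arg2 recursive_id assms)
  ultimately show ?thesis by simp
qed

lemma recursive_power:
  assumes "recursive a" and "recursive b"
  shows "recursive (\<lambda>x. a x ^ b x)"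
proof -
  have "rec_nat 1 (\<lambda>k r. m * r) n = m ^ n" for m n :: nat
    by (induction n) auto
  moreover have "recursive (\<lambda>x. rec_nat 1 (\<lambda>k r. a x * r) (b x))"
    by (intro recursive_rec_nat recursive_mult recursive_comp[OF assms(1)] recursive_const
        recursive_arg1 recursive_arg2 recursive_id assms)
  ultimately show ?thesis by simp
qed

lemma recursive_pred:
  assumes "recursive a"
  shows "recursive (\<lambda>x. a x - 1)"
proof -
  have "rec_nat 0 (\<lambda>k r. k) n = n - 1" for n
    by (cases n) auto
  moreover have "recursive (\<lambda>x. rec_nat 0 (\<lambda>k r. k) (a x))"
    by (intro recursive_rec_nat recursive_const recursive_arg1 recursive_arg2 recursive_id assms)
  ultimately show ?thesis by simp
qed

lemma recursive_diff:
  assumes "recursive a" and "recursive b"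
  shows "recursive (\<lambda>x. a x - b x)"
proof -
  have "rec_nat m (\<lambda>k r. r - 1) n = m - n" for m n :: nat
    by (induction n) auto
  moreover have "recursive (\<lambda>x. rec_nat (a x) (\<lambda>k r. r - 1) (b x))"
    by (intro recursive_rec_nat recursive_pred recursive_arg2 recursive_id assms)
  ultimately show ?thesis by simp
qed

lemma recursive_sum:
  assumes "recursive (\<lambda>y. f (arg1 y) (arg2 y))" and "recursive n"
  shows "recursive (\<lambda>x. \<Sum>t<n x. f x t)"
proof -
  have "rec_nat 0 (\<lambda>k r. f x k + r) m = (\<Sum>t<m. f x t)" for x m
    by (induction m) auto
  moreover have "recursive2 f"
    using assms(1) by (simp add: recursive2_def)
  then have "recursive (\<lambda>x. rec_nat 0 (\<lambda>k r. f x k + r) (n x))"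
    by (intro recursive_rec_nat recursive_add recursive_comp2[of f] recursive_const
        recursive_arg1 recursive_arg2 recursive_id assms)
  ultimately show ?thesis by simp
qed

section \<open>Decidable predicates, represented by their characteristic functions\<close>

lemma recursive_not:
  assumes "recursive (\<lambda>x. of_bool (P x))"
  shows "recursive (\<lambda>x. of_bool (\<not> P x))"
proof -
  have "of_bool (\<not> P x) = 1 - (of_bool (P x) :: nat)" for x
    by simp
  then show ?thesis
    by (simp only:) (intro recursive_diff recursive_const assms)
qed

lemma recursive_conj:
  assumes "recursive (\<lambda>x. of_bool (P x))" and "recursive (\<lambda>x. of_bool (Q x))"
  shows "recursive (\<lambda>x. of_bool (P x \<and> Q x))"
  unfolding of_bool_conj by (intro recursive_mult assms)

lemma recursive_disj:
  assumes "recursive (\<lambda>x. of_bool (P x))" and "recursive (\<lambda>x. of_bool (Q x))"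
  shows "recursive (\<lambda>x. of_bool (P x \<or> Q x))"
  using recursive_not[OF recursive_conj[OF assms[THEN recursive_not]]] by simp

lemma recursive_le:
  assumes "recursive a" and "recursive b"
  shows "recursive (\<lambda>x. of_bool (a x \<le> b x))"
proof -
  have "of_bool (m \<le> n) = 1 - (m - n)" for m n :: nat
    by auto
  then show ?thesis
    by (simp only:) (intro recursive_diff recursive_const assms)
qed

lemma recursive_less:
  assumes "recursive a" and "recursive b"
  shows "recursive (\<lambda>x. of_bool (a x < b x))"
  using recursive_not[OF recursive_le[OF assms(2,1)]] by (simp add: not_le)

lemma recursive_eq:
  assumes "recursive a" and "recursive b"
  shows "recursive (\<lambda>x. of_bool (a x = b x))"
  unfolding order.eq_iff by (intro recursive_conj recursive_le assms)

lemma recursive_if: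
  assumes "recursive (\<lambda>x. of_bool (P x))" and "recursive a" and "recursive b"
  shows "recursive (\<lambda>x. if P x then a x else b x)"
proof -
  have "(if P x then a x else b x) = of_bool (P x) * a x + (1 - of_bool (P x)) * b x" for x
    by simp
  then show ?thesis
    by (simp only:) (intro recursive_add recursive_mult recursive_diff recursive_const assms)
qed

lemma minimize_total:
  assumes "\<exists>k. h k = 0"
  shows "minimize (\<lambda>k. Some (h k)) = Some (LEAST k. h k = 0)"
  using assms by (auto simp: minimize_def)

text \<open>\<open>Mu\<close> searches for a zero, hence the negated predicate; \<open>ex\<close>
  makes every search terminate.\<close>

lemma recursive_Least:
  assumes "recursive (\<lambda>y. of_bool (P (arg1 y) (arg2 y)))" and ex: "\<And>x. \<exists>k. P x k"
  shows "recursive (\<lambda>x. LEAST k. P x k)"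
proof -
  obtain p where p: "query_free p"
    "\<And>X y. run X p y = Some (of_bool (\<not> P (arg1 y) (arg2 y)))"
    using recursive_not[OF assms(1)] by (meson recursiveE)
  then show ?thesis
    using ex by (intro recursiveI[of "Mu p"]) (simp_all add: minimize_total)
qed

lemma recursive_div:
  assumes "recursive a" and "recursive b"
  shows "recursive (\<lambda>x. a x div b x)"
proof -
  \<comment> \<open>The disjunct \<open>b x = 0\<close> stops the search at 0, matching the
    convention that division by 0 yields 0.\<close>
  have *: "(LEAST q. b x = 0 \<or> a x < Suc q * b x) = a x div b x" for x
  proof (cases "b x = 0")
    case False
    then show ?thesis
      by (intro Least_equality)
        (auto simp: dividend_less_div_times less_Suc_eq_le[symmetric] div_less_iff_less_mult)
  qed (simp add: Least_equality)
  have "recursive (\<lambda>x. LEAST q. b x = 0 \<or> a x < Suc q * b x)"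
    by (intro recursive_Least recursive_disj recursive_eq recursive_less recursive_const
        recursive_mult recursive_Suc recursive_comp[OF assms(1)] recursive_comp[OF assms(2)]
        recursive_arg1 recursive_arg2 recursive_id)
      (metis bot_nat_0.not_eq_extremum dividend_less_div_times mult_Suc add.commute)
  then show ?thesis by (simp only: *)
qed

lemma recursive_mod:
  assumes "recursive a" and "recursive b"
  shows "recursive (\<lambda>x. a x mod b x)"
  unfolding minus_div_mult_eq_mod[symmetric]
  by (intro recursive_diff recursive_mult recursive_div assms)

lemmas recursive_intros =
  recursive_id recursive_const recursive_Suc recursive_arg1 recursive_arg2
  recursive_prod_encode recursive_rec_nat recursive_pred recursive_add recursive_mult
  recursive_power recursive_diff recursive_sum recursive_div recursive_mod
  recursive_not recursive_conj recursive_disj recursive_le recursive_less recursive_eq recursive_if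

section \<open>Operations on partial recursive functions\<close>

lemma partial_recursive_comp:
  assumes "partial_recursive \<phi>" and "recursive a"
  shows "partial_recursive (\<lambda>x. \<phi> (a x))"
proof -
  obtain p q where "query_free p" "\<And>X n. run X p n = \<phi> n"
    "query_free q" "\<And>X n. run X q n = Some (a n)"
    using assms by (meson partial_recursiveE recursiveE)
  then show ?thesis
    unfolding partial_recursive_def by (intro exI[of _ "Comp p q"]) auto
qed

lemma partial_recursive_map:
  assumes "recursive2 h" and "partial_recursive \<phi>"
  shows "partial_recursive (\<lambda>x. map_option (h x) (\<phi> x))"
proof -
  obtain p q where "query_free p" "\<And>X n. run X p n = Some (h (arg1 n) (arg2 n))"
    "query_free q" "\<And>X n. run X q n = \<phi> n"
    using assms unfolding recursive2_def by (meson partial_recursiveE recursiveE)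
  then show ?thesis
    unfolding partial_recursive_def
    by (intro exI[of _ "Comp p (Tuple (Tuple Fst Snd) q)"])
      (auto simp: fun_eq_iff split: option.splits bind_splits)
qed

lemma partial_recursive_guard:
  assumes "recursive (\<lambda>x. of_bool (P x))" and "partial_recursive \<phi>"
  shows "partial_recursive (\<lambda>x. if P x then \<phi> x else None)"
proof -
  obtain p q where "query_free p" "\<And>X n. run X p n = Some (of_bool (\<not> P n))"
    "query_free q" "\<And>X n. run X q n = \<phi> n"
    using assms recursive_not[OF assms(1)] by (meson partial_recursiveE recursiveE)
  then show ?thesis
    unfolding partial_recursive_def
    \<comment> \<open>The minimised function ignores the search variable: the search stops at once
      if \<open>P\<close> holds and diverges otherwise. \<open>Snd\<close> then drops its result and
      keeps the input.\<close>
    by (intro exI[of _ "Comp q (Comp Snd (Tuple (Mu (Comp p Fst)) (Tuple Fst Snd)))"])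
      (auto simp: fun_eq_iff minimize_def)
qed

section \<open>Computing with coded strings\<close>

lemma prod_decode_0: "prod_decode 0 = (0, 0)"
  using prod_encode_inverse[of "(0, 0)"] by (simp add: prod_encode_def)

text \<open>Inverts \<open>list_encode (x # xs) = Suc (prod_encode (x, list_encode xs))\<close>.
  Since \<open>prod_decode 0 = (0, 0)\<close>, the code 0 of the empty list is its own tail, as for
  \<open>tl\<close>.\<close>

definition code_tl :: "nat \<Rightarrow> nat" where "code_tl L = arg2 (L - 1)"

definition code_drop :: "nat \<Rightarrow> nat \<Rightarrow> nat" where
  "code_drop L j = rec_nat L (\<lambda>_. code_tl) j"

definition code_nth :: "nat \<Rightarrow> nat \<Rightarrow> nat" where
  "code_nth L j = arg1 (code_drop L j - 1)"

lemma code_drop_list_encode: "code_drop (list_encode xs) j = list_encode (drop j xs)"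
proof (induction j)
  case (Suc j)
  have "code_tl (list_encode ys) = list_encode (tl ys)" for ys
    by (cases ys) (auto simp: code_tl_def prod_decode_0)
  with Suc show ?case
    by (simp add: code_drop_def drop_Suc tl_drop)
qed (simp add: code_drop_def)

lemma code_nth_list_encode:
  "code_nth (list_encode xs) j = (if j < length xs then xs ! j else 0)"
proof (cases "j < length xs")
  case True
  then have "drop j xs = xs ! j # drop (Suc j) xs"
    by (rule Cons_nth_drop_Suc[symmetric])
  with True show ?thesis
    by (simp add: code_nth_def code_drop_list_encode)
qed (simp add: code_nth_def code_drop_list_encode prod_decode_0)

lemma code_drop_encode_string: "code_drop (encode_string \<sigma>) j = encode_string (drop j \<sigma>)"
  by (simp add: encode_string_def code_drop_list_encode drop_map)

lemma code_nth_encode_string: "code_nth (encode_string \<sigma>) j = of_bool (j < length \<sigma> \<and> \<sigma> ! j)"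
  by (simp add: encode_string_def code_nth_list_encode)

lemma encode_string_eq_0_iff: "encode_string \<sigma> = 0 \<longleftrightarrow> \<sigma> = []"
  by (cases \<sigma>) (auto simp: encode_string_def)

text \<open>Every number codes a list, and reading past its end gives 0. Hence the search for the
  first 0 terminates on all numbers, not only on codes of bit strings.\<close>

lemma ex_code_nth_eq_0: "\<exists>j. code_nth L j = 0"
proof -
  obtain xs where "L = list_encode xs"
    by (metis list_decode_inverse)
  then show ?thesis
    by (auto simp: code_nth_list_encode intro!: exI[of _ "length xs"])
qed

lemma recursive_code_drop:
  "recursive a \<Longrightarrow> recursive b \<Longrightarrow> recursive (\<lambda>x. code_drop (a x) (b x))"
  unfolding code_drop_def code_tl_def by (intro recursive_intros)

lemma recursive_code_nth:
  "recursive a \<Longrightarrow> recursive b \<Longrightarrow> recursive (\<lambda>x. code_nth (a x) (b x))"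
  unfolding code_nth_def by (intro recursive_intros recursive_code_drop)

text \<open>A code grows at its front, so the recursion runs from the last bit backwards: after
  \<open>k\<close> rounds it holds the last \<open>k\<close> bits.\<close>

lemma encode_string_map:
  "encode_string (map P [0..<n]) =
     rec_nat 0 (\<lambda>k r. Suc (prod_encode (of_bool (P (n - Suc k)), r))) n"
proof -
  have "k \<le> n \<Longrightarrow> rec_nat 0 (\<lambda>k r. Suc (prod_encode (of_bool (P (n - Suc k)), r))) k
      = encode_string (map P [n - k..<n])" for k
  proof (induction k)
    case (Suc k)
    then have "[n - Suc k..<n] = (n - Suc k) # [n - k..<n]"
      by (simp add: upt_conv_Cons Suc_diff_Suc)
    with Suc show ?case by (simp add: encode_string_def)
  qed (simp add: encode_string_def)
  from this[of n] show ?thesis by simp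
qed

lemma recursive_encode_string_map:
  assumes P: "recursive (\<lambda>y. of_bool (P (arg1 y) (arg2 y)))" and n: "recursive n"
  shows "recursive (\<lambda>x. encode_string (map (P x) [0..<n x]))"
proof -
  have "recursive2 (\<lambda>x j. of_bool (P x j))"
    using P by (simp add: recursive2_def)
  note P' = recursive_comp2[OF this]
  show ?thesis
    unfolding encode_string_map
    by (intro recursive_intros P' recursive_comp[OF n])
qed

section \<open>A Toeplitz coding\<close>

text \<open>Reversal of the \<open>m\<close> lowest binary digits; it numbers the residue classes
  modulo \<open>2 ^ m\<close> so that class \<open>w\<close> splits at level \<open>m + 1\<close>
  into \<open>2 * w\<close> and \<open>2 * w + 1\<close>. Initial segments of classes thus refine to
  initial segments.\<close>

definition bitrev :: "nat \<Rightarrow> nat \<Rightarrow> nat" where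
  "bitrev m x = (\<Sum>t<m. x div 2 ^ t mod 2 * 2 ^ (m - Suc t))"

lemma bitrev_0 [simp]: "bitrev 0 x = 0"
  by (simp add: bitrev_def)

lemma bitrev_Suc: "bitrev (Suc m) x = 2 * bitrev m x + x div 2 ^ m mod 2"
proof -
  have "(\<Sum>t<m. x div 2 ^ t mod 2 * 2 ^ (m - t)) = 2 * bitrev m x"
    unfolding bitrev_def sum_distrib_left
    by (intro sum.cong) (auto simp: Suc_diff_Suc[symmetric])
  then show ?thesis by (simp add: bitrev_def)
qed

lemma bitrev_add: "bitrev m (x + 2 ^ m * y) = bitrev m x"
proof (induction m arbitrary: y)
  case (Suc m)
  have "(x + 2 ^ Suc m * y) div 2 ^ m mod 2 = x div 2 ^ m mod 2"
    by (simp add: mult.assoc mult.left_commute[of 2])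
  moreover have "bitrev m (x + 2 ^ Suc m * y) = bitrev m x"
    using Suc[of "2 * y"] by (simp add: ac_simps)
  ultimately show ?case by (simp add: bitrev_Suc)
qed simp

lemma bitrev_surj: "w < 2 ^ m \<Longrightarrow> \<exists>x<2 ^ m. bitrev m x = w"
proof (induction m arbitrary: w)
  case (Suc m)
  then have "w div 2 < 2 ^ m" by auto
  with Suc obtain x where x: "x < 2 ^ m" "bitrev m x = w div 2"
    by blast
  \<comment> \<open>The lowest digit of \<open>w\<close> becomes the highest digit of the preimage;
    the remaining digits reverse \<open>w div 2\<close>.\<close>
  let ?y = "x + 2 ^ m * (w mod 2)"
  have "bitrev (Suc m) ?y = w"
    using x by (simp add: bitrev_Suc bitrev_add)
  moreover have "2 ^ m * (w mod 2) \<le> (2::nat) ^ m"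
    by simp
  then have "?y < 2 ^ Suc m"
    using x(1) unfolding power_Suc by linarith
  ultimately show ?case by blast
qed auto

lemma bitrev_surj_window:
  assumes "w < 2 ^ m"
  shows "\<exists>j<2 ^ m. bitrev m (i + j) = w"
proof -
  obtain x where x: "x < 2 ^ m" "bitrev m x = w"
    using bitrev_surj[OF assms] by blast
  define r :: nat where "r = i mod 2 ^ m"
  have r: "r < 2 ^ m" by (simp add: r_def)
  \<comment> \<open>The forward distance from \<open>r\<close> to \<open>x\<close> on the cycle of
    residues modulo \<open>2 ^ m\<close>.\<close>
  define j where "j = (if r \<le> x then x - r else x + 2 ^ m - r)"
  have "r + j = x \<or> r + j = x + 2 ^ m * 1"
    using r by (auto simp: j_def)
  then have "bitrev m (r + j) = w"
    using x(2) bitrev_add by metis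
  moreover have "i + j = (r + j) + 2 ^ m * (i div 2 ^ m)"
    by (simp add: r_def)
  ultimately have "bitrev m (i + j) = w"
    using bitrev_add by metis
  moreover have "j < 2 ^ m"
    using r x(1) by (auto simp: j_def)
  ultimately show ?thesis by blast
qed

text \<open>The partial sum of \<open>F l / 2 ^ l\<close> up to \<open>l = m\<close>, scaled by
  \<open>2 ^ m\<close>: the number of classes modulo \<open>2 ^ m\<close> claimed by the levels up
  to \<open>m\<close>. Level \<open>m\<close> itself claims the last \<open>F m\<close> of
  these.\<close>

definition load :: "(nat \<Rightarrow> nat) \<Rightarrow> nat \<Rightarrow> nat" where
  "load F m = (\<Sum>l<Suc m. F l * 2 ^ (m - l))"

lemma load_Suc: "load F (Suc m) = 2 * load F m + F (Suc m)"
proof -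
  have "(\<Sum>l<Suc m. F l * 2 ^ (Suc m - l)) = 2 * load F m"
    unfolding load_def sum_distrib_left
    by (intro sum.cong) (auto simp: Suc_diff_le)
  then show ?thesis by (simp add: load_def)
qed

lemma le_load: "F m \<le> load F m"
  by (simp add: load_def)

text \<open>Position \<open>x\<close> is occupied at the first level \<open>l\<close> with \<open>bitrev l x < load F l\<close>; the positions
  occupied at level \<open>l\<close> carry the bits \<open>0, \<dots>, F l - 1\<close>, each with period \<open>2 ^ l\<close>. The cut-off
  \<open>x \<le> l\<close> makes the search terminate; positions that run into it carry a bit of no significance.\<close>

definition source :: "(nat \<Rightarrow> nat) \<Rightarrow> nat \<Rightarrow> nat" where
  "source F x =
     (let l = (LEAST l. bitrev l x < load F l \<or> x \<le> l) in bitrev l x - (load F l - F l))"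

text \<open>Refining a class below \<open>load F m\<close> gives a class below
  \<open>2 * load F m\<close>, which is where level \<open>m + 1\<close> begins. So different levels
  claim disjoint sets of positions.\<close>

lemma bitrev_less_load_mono:
  assumes "bitrev l x < load F l" and "l < m"
  shows "bitrev m x < load F m - F m"
  using assms(2)
proof (induction m)
  case (Suc m)
  have "bitrev m x < load F m"
    using Suc assms(1) by (cases "l = m") auto
  moreover have "x div 2 ^ m mod 2 < 2"
    by simp
  ultimately have "bitrev (Suc m) x < 2 * load F m"
    unfolding bitrev_Suc by linarith
  then show ?case by (simp add: load_Suc)
qed simp

text \<open>No earlier level claims \<open>x\<close>, as its class would then lie below
  \<open>load F m - F m\<close>; and \<open>m \<le> x\<close> prevents the cut-off from ending the
  search before level \<open>m\<close>.\<close>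

lemma source_eq:
  assumes "bitrev m x = load F m - F m + k" and "k < F m" and "m \<le> x"
  shows "source F x = k"
proof -
  have "(LEAST l. bitrev l x < load F l \<or> x \<le> l) = m"
  proof (rule Least_equality)
    show "bitrev m x < load F m \<or> x \<le> m"
      using assms(1,2) le_load[of F m] by linarith
    show "m \<le> l" if "bitrev l x < load F l \<or> x \<le> l" for l
      using that assms bitrev_less_load_mono[of l x F m] by (cases "l < m") auto
  qed
  then show ?thesis
    by (simp add: source_def assms(1))
qed

text \<open>Here \<open>r\<close> stands for the starting position modulo \<open>2 ^ m\<close>. The
  search begins \<open>2 ^ m\<close> letters into the window to stay clear of the cut-off in
  \<open>source\<close>; the bound on \<open>j\<close> and the default \<open>False\<close> make the
  decoder total on arbitrary strings.\<close>

definition window_decode :: "(nat \<Rightarrow> nat) \<Rightarrow> nat \<Rightarrow> nat \<Rightarrow> bool list \<Rightarrow> bool list" where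
  "window_decode F m r \<tau> =
     map (\<lambda>k. let j = 2 ^ m + (LEAST j. bitrev m (r + j) = load F m - F m + k \<or> 2 ^ m \<le> j)
              in j < length \<tau> \<and> \<tau> ! j) [0..<F m]"

lemma window_decode_window:
  assumes "load F m \<le> 2 ^ m" and "2 ^ Suc m \<le> n"
  shows "window_decode F m (i mod 2 ^ m) (map (X \<circ> source F) [i..<i + n]) = map X [0..<F m]"
  unfolding window_decode_def
proof (rule map_cong[OF refl])
  fix k assume "k \<in> set [0..<F m]"
  then have k: "k < F m" by simp
  let ?w = "load F m - F m + k"
  define j where "j = (LEAST j. bitrev m (i mod 2 ^ m + j) = ?w \<or> 2 ^ m \<le> j)"
  have "?w < 2 ^ m"
    using k le_load[of F m] assms(1) by linarith
  from bitrev_surj_window[OF this] obtain j0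
    where j0: "j0 < 2 ^ m" "bitrev m (i mod 2 ^ m + j0) = ?w"
    by blast
  let ?P = "\<lambda>j. bitrev m (i mod 2 ^ m + j) = ?w \<or> 2 ^ m \<le> j"
  have "?P j0"
    using j0 by blast
  then have "?P j" and "j \<le> j0"
    using LeastI[of ?P j0] Least_le[of ?P j0] unfolding j_def[symmetric] by blast+
  with j0(1) have j: "j < 2 ^ m" "bitrev m (i mod 2 ^ m + j) = ?w"
    by auto
  have "i + (2 ^ m + j) = (i mod 2 ^ m + j) + 2 ^ m * (i div 2 ^ m + 1)"
    by (simp add: algebra_simps)
  then have "bitrev m (i + (2 ^ m + j)) = ?w"
    using j(2) bitrev_add by metis
  \<comment> \<open>Holds even for \<open>i = 0\<close>, thanks to the skipped first half of the
    window.\<close>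
  moreover have "m \<le> i + (2 ^ m + j)"
    using less_exp[of m] by linarith
  ultimately have "source F (i + (2 ^ m + j)) = k"
    using k source_eq by blast
  then show "(let j = 2 ^ m + (LEAST j. bitrev m (i mod 2 ^ m + j) = ?w \<or> 2 ^ m \<le> j)
      in j < length (map (X \<circ> source F) [i..<i + n]) \<and> map (X \<circ> source F) [i..<i + n] ! j) = X k"
    using assms(2) j(1) unfolding j_def[symmetric] by simp
qed

section \<open>Recursiveness of the coding\<close>

lemma recursive_bitrev:
  assumes "recursive a" and "recursive b"
  shows "recursive (\<lambda>x. bitrev (a x) (b x))"
  unfolding bitrev_def
  by (intro recursive_intros recursive_comp[OF assms(1)] recursive_comp[OF assms(2)])

lemma recursive_load:
  assumes "recursive F" and "recursive a"
  shows "recursive (\<lambda>x. load F (a x))"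
  unfolding load_def
  by (intro recursive_intros recursive_comp[OF assms(1)] recursive_comp[OF assms(2)])

lemma recursive_source:
  assumes "recursive F"
  shows "recursive (source F)"
proof -
  have level: "recursive (\<lambda>x. LEAST l. bitrev l x < load F l \<or> x \<le> l)"
    by (intro recursive_Least recursive_disj recursive_less recursive_le recursive_bitrev recursive_load recursive_arg1 recursive_arg2 recursive_id assms) auto
  then show ?thesis
    unfolding source_def[abs_def] Let_def
    by (intro recursive_diff recursive_bitrev recursive_load recursive_comp[OF assms] level
        recursive_id assms)
qed

section \<open>Complexity of the windows\<close>

text \<open>Holds also for a string of ones only, since reading past the end gives 0.\<close>

lemma length_takeWhile_eq_Least:
  "length (takeWhile id \<sigma>) = (LEAST j. code_nth (encode_string \<sigma>) j = 0)"
proof (rule Least_equality[symmetric])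
  show "code_nth (encode_string \<sigma>) (length (takeWhile id \<sigma>)) = 0"
    using nth_length_takeWhile[of id \<sigma>] by (auto simp: code_nth_encode_string)
next
  fix j assume j: "code_nth (encode_string \<sigma>) j = 0"
  show "length (takeWhile id \<sigma>) \<le> j"
  proof (rule ccontr)
    assume "\<not> length (takeWhile id \<sigma>) \<le> j"
    then have "j < length (takeWhile id \<sigma>)" by simp
    then have "\<sigma> ! j" "j < length \<sigma>"
      using nth_mem[of j "takeWhile id \<sigma>"] set_takeWhileD[of "takeWhile id \<sigma> ! j" id \<sigma>]
        length_takeWhile_le[of id \<sigma>] by (auto simp: takeWhile_nth)
    with j show False by (simp add: code_nth_encode_string)
  qed
qed

text \<open>On input \<open>1\<^sup>m 0 b\<^sub>1 \<dots> b\<^sub>m \<rho>\<close>: run \<open>U\<close> on \<open>\<rho>\<close> and decode the result as a window whose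
  starting position has the binary digits \<open>b\<^sub>1, \<dots>, b\<^sub>m\<close> modulo \<open>2 ^ m\<close>, least significant first.\<close>

definition window_machine ::
  "(nat \<Rightarrow> nat) \<Rightarrow> (bool list \<Rightarrow> bool list option) \<Rightarrow> bool list \<Rightarrow> bool list option" where
  "window_machine F U \<sigma> =
     (let m = length (takeWhile id \<sigma>)
      in if 2 * m < length \<sigma>
         then map_option (window_decode F m (horner_sum of_bool 2 (take m (drop (Suc m) \<sigma>))))
                (U (drop (Suc (2 * m)) \<sigma>))
         else None)"

lemma window_machine_append:
  "window_machine F U (replicate m True @ False # map (bit i) [0..<m] @ \<rho>) =
     map_option (window_decode F m (i mod 2 ^ m)) (U \<rho>)"
  by (simp add: window_machine_def takeWhile_append horner_sum_bit_eq_take_bit take_bit_eq_mod)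

lemma partial_recursive_window_machine:
  assumes F: "recursive F" and \<phi>: "partial_recursive \<phi>"
    and U: "\<And>\<sigma>. \<phi> (encode_string \<sigma>) = map_option encode_string (U \<sigma>)"
  shows "\<exists>\<psi>. partial_recursive \<psi> \<and>
    (\<forall>\<sigma>. \<psi> (encode_string \<sigma>) = map_option encode_string (window_machine F U \<sigma>))"
proof -
  \<comment> \<open>Counterparts on codes of the header length, the starting residue, the search for
    bit \<open>k\<close>, and the decoder.\<close>
  define m where "m L = (LEAST j. code_nth L j = 0)" for L
  define r where "r L = (\<Sum>t<m L. code_nth L (Suc (m L) + t) * 2 ^ t)" for L
  define j where "j L k = (LEAST j. bitrev (m L) (r L + j) = load F (m L) - F (m L) + k \<or>
    2 ^ m L \<le> j)" for L k
  define d where "d L t =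
    encode_string (map (\<lambda>k. code_nth t (2 ^ m L + j L k) \<noteq> 0) [0..<F (m L)])" for L t
  \<comment> \<open>A nonzero code after dropping \<open>2 * m L\<close> letters means a nonempty
    rest, which is the length test of the machine.\<close>
  define \<psi> where "\<psi> L = (if code_drop L (2 * m L) \<noteq> 0
    then map_option (d L) (\<phi> (code_drop L (Suc (2 * m L)))) else None)" for L
  have m: "recursive m"
    unfolding m_def by (intro recursive_Least recursive_intros recursive_code_nth ex_code_nth_eq_0)
  note m' = recursive_comp[OF m]
  have r: "recursive r"
    unfolding r_def by (intro recursive_intros recursive_code_nth m')
  note r' = recursive_comp[OF r]
  have j: "recursive2 j"
    unfolding j_def recursive2_def
    by (intro recursive_Least recursive_intros recursive_bitrev recursive_load
        recursive_comp[OF F] m' r' F) (meson order_refl)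
  have d: "recursive2 d"
    unfolding d_def recursive2_def
    by (intro recursive_encode_string_map recursive_intros recursive_code_nth
        recursive_comp[OF F] recursive_comp2[OF j] m')
  have "partial_recursive \<psi>"
    unfolding \<psi>_def
    by (intro partial_recursive_guard partial_recursive_map[OF d] partial_recursive_comp[OF \<phi>]
        recursive_intros recursive_code_drop m)
  moreover have "\<psi> (encode_string \<sigma>) = map_option encode_string (window_machine F U \<sigma>)" for \<sigma>
  proof (cases "2 * length (takeWhile id \<sigma>) < length \<sigma>")
    case True
    let ?L = "encode_string \<sigma>"
    have mL: "m ?L = length (takeWhile id \<sigma>)"
      by (simp add: m_def length_takeWhile_eq_Least)
    have rL: "r ?L = horner_sum of_bool 2 (take (m ?L) (drop (Suc (m ?L)) \<sigma>))"
      using True unfolding r_def mL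
      by (simp add: horner_sum_eq_sum code_nth_encode_string lessThan_atLeast0)
    have "d ?L (encode_string \<tau>) = encode_string (window_decode F (m ?L) (r ?L) \<tau>)" for \<tau>
      by (simp add: d_def window_decode_def j_def code_nth_encode_string Let_def)
    with True show ?thesis
      by (simp add: \<psi>_def window_machine_def mL[symmetric] rL[symmetric] code_drop_encode_string
          encode_string_eq_0_iff U option.map_comp comp_def Let_def)
  next
    case False
    then show ?thesis
      by (simp add: \<psi>_def window_machine_def m_def length_takeWhile_eq_Least[symmetric]
          code_drop_encode_string encode_string_eq_0_iff)
  qed
  ultimately show ?thesis by blast
qed

lemma prefix_free_window_machine:
  assumes "recursive F" and "prefix_free_machine U"
  shows "prefix_free_machine (window_machine F U)"
  unfolding prefix_free_machine_def
proof
  show "\<exists>\<phi>. partial_recursive \<phi> \<and>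
      (\<forall>\<sigma>. \<phi> (encode_string \<sigma>) = map_option encode_string (window_machine F U \<sigma>))"
    using assms partial_recursive_window_machine unfolding prefix_free_machine_def by blast
  show "\<forall>\<sigma>\<in>dom (window_machine F U). \<forall>\<tau>\<in>dom (window_machine F U). prefix \<sigma> \<tau> \<longrightarrow> \<sigma> = \<tau>"
  proof (intro ballI impI)
    fix \<sigma> \<tau> assume *: "\<sigma> \<in> dom (window_machine F U)" "\<tau> \<in> dom (window_machine F U)" "prefix \<sigma> \<tau>"
    then obtain \<zeta> where \<tau>: "\<tau> = \<sigma> @ \<zeta>" by (auto simp: prefix_def)
    let ?m = "length (takeWhile id \<sigma>)"
    have 1: "2 * ?m < length \<sigma>" "drop (Suc (2 * ?m)) \<sigma> \<in> dom U"
      using *(1) by (auto simp: window_machine_def Let_def split: if_splits)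
    \<comment> \<open>The block of ones ends inside \<open>\<sigma>\<close>, so every extension has
      the same header length and passes to \<open>U\<close> an extension of the same
      program.\<close>
    then have "takeWhile id \<sigma> \<noteq> \<sigma>" by (metis mult_2 not_add_less1)
    then have "takeWhile id \<tau> = takeWhile id \<sigma>"
      unfolding \<tau> by (metis takeWhile_append1 takeWhile_eq_all_conv)
    with *(2) 1(1) have "drop (Suc (2 * ?m)) \<sigma> @ \<zeta> \<in> dom U"
      by (auto simp: window_machine_def Let_def \<tau> split: if_splits)
    with 1(2) assms(2) have "\<zeta> = []"
      unfolding prefix_free_machine_def by (metis prefixI append_self_conv)
    with \<tau> show "\<sigma> = \<tau>" by simp
  qed
qed

text \<open>The machine defined only at the empty string, with output \<open>\<tau>\<close>, is
  prefix-free; \<open>U\<close> simulates it. Hence the minimum in \<open>K\<close> is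
  attained.\<close>

lemma universal_machine_surj:
  assumes "universal_machine U"
  shows "\<exists>\<sigma>. U \<sigma> = Some \<tau>"
proof -
  define M :: "bool list \<Rightarrow> bool list option" where "M = [[] \<mapsto> \<tau>]"
  have "partial_recursive (\<lambda>x. if x = 0 then Some (encode_string \<tau>) else None)"
    by (intro partial_recursive_guard recursive_intros recursive_const[unfolded recursive_def])
  moreover have "(if encode_string \<sigma> = 0 then Some (encode_string \<tau>) else None) =
      map_option encode_string (M \<sigma>)" for \<sigma>
    by (simp add: M_def encode_string_eq_0_iff)
  moreover have "dom M = {[]}"
    by (simp add: M_def)
  ultimately have "prefix_free_machine M"
    unfolding prefix_free_machine_def by auto
  with assms obtain \<rho> where "\<And>\<sigma>. U (\<rho> @ \<sigma>) = M \<sigma>"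
    unfolding universal_machine_def by blast
  from this[of "[]"] show ?thesis
    by (auto simp: M_def)
qed

section \<open>Comparing the complexity of initial segments with that of windows\<close>

lemma K_le: "U \<tau> = Some \<sigma> \<Longrightarrow> K U \<sigma> \<le> length \<tau>"
  unfolding K_def by (rule Least_le) blast

lemma K_description:
  assumes "universal_machine U"
  obtains \<tau> where "U \<tau> = Some \<sigma>" and "length \<tau> = K U \<sigma>"
proof -
  have "\<exists>k \<tau>. U \<tau> = Some \<sigma> \<and> k = length \<tau>"
    using universal_machine_surj[OF assms] by blast
  from LeastI_ex[OF this] that show thesis
    unfolding K_def by metis
qed

text \<open>A shortest description of the window, preceded by the simulation prefix and a header of
  \<open>2 * m + 1\<close> bits, describes the initial segment. The constant comes from that prefix
  and the separating 0 alone.\<close>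

lemma K_window:
  assumes U: "universal_machine U" and F: "recursive F" and load: "\<And>m. load F m \<le> 2 ^ m"
  obtains c where "\<And>(X :: nat \<Rightarrow> bool) i n m. 2 ^ Suc m \<le> n \<Longrightarrow>
    K U (map X [0..<F m]) \<le> K U (map (X \<circ> source F) [i..<i + n]) + 2 * m + c"
proof -
  have "prefix_free_machine (window_machine F U)"
    using U F by (simp add: prefix_free_window_machine universal_machine_def)
  with U obtain \<rho> where \<rho>: "\<And>\<tau>. U (\<rho> @ \<tau>) = window_machine F U \<tau>"
    unfolding universal_machine_def by blast
  show thesis
  proof (rule that)
    fix X :: "nat \<Rightarrow> bool" and i m n :: nat assume n: "2 ^ Suc m \<le> n"
    let ?Y = "map (X \<circ> source F) [i..<i + n]"
    obtain \<tau> where \<tau>: "U \<tau> = Some ?Y" "length \<tau> = K U ?Y"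
      by (rule K_description[OF U])
    have "U (\<rho> @ replicate m True @ False # map (bit i) [0..<m] @ \<tau>) = Some (map X [0..<F m])"
      unfolding \<rho> window_machine_append \<tau>(1) using window_decode_window[OF load n] by simp
    from K_le[of U, OF this] \<tau>(2)
    show "K U (map X [0..<F m]) \<le> K U ?Y + 2 * m + Suc (length \<rho>)"
      by simp
  qed
qed

section \<open>Growth rates\<close>

text \<open>The integer part of \<open>2 ^ k * max 0 (decode_rat c)\<close>: odd numbers code the
  negative integers, which are replaced by 0.\<close>

definition nat_approx :: "nat \<Rightarrow> nat \<Rightarrow> nat" where
  "nat_approx k c =
     2 ^ k * (if arg1 c mod 2 = 0 then arg1 c div 2 else 0) div Suc (arg2 c)"

text \<open>One unit of error comes from the scaled approximation, which clamping at 0 cannot worsen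
  as \<open>x\<close> is nonnegative, and one from rounding.\<close>

lemma nat_approx:
  assumes "0 \<le> x" and "\<bar>x - decode_rat c\<bar> \<le> 1 / 2 ^ k"
  shows "\<bar>2 ^ k * x - real (nat_approx k c)\<bar> \<le> 2"
proof -
  define z where "z = (if arg1 c mod 2 = 0 then arg1 c div 2 else 0)"
  define d where "d = Suc (arg2 c)"
  have q: "nat_approx k c = 2 ^ k * z div d"
    by (simp add: nat_approx_def z_def d_def)
  have max: "real z / real d = max 0 (decode_rat c)"
  proof (cases "even (arg1 c)")
    case True
    then show ?thesis
      by (auto simp: decode_rat_def z_def d_def int_decode_def sum_decode_def case_prod_beta
          even_iff_mod_2_eq_zero)
  next
    case False
    then have "decode_rat c \<le> 0"
      by (auto simp: decode_rat_def int_decode_def sum_decode_def case_prod_beta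
          intro!: divide_nonpos_pos)
    with False show ?thesis
      by (simp add: z_def even_iff_mod_2_eq_zero)
  qed
  have "\<bar>x - real z / real d\<bar> \<le> 1 / 2 ^ k"
    using assms unfolding max by linarith
  then have "2 ^ k * \<bar>x - real z / real d\<bar> \<le> 2 ^ k * (1 / 2 ^ k)"
    by (intro mult_left_mono) auto
  moreover have "2 ^ k * \<bar>x - real z / real d\<bar> = \<bar>2 ^ k * (x - real z / real d)\<bar>"
    by (simp add: abs_mult)
  ultimately have 1: "\<bar>2 ^ k * x - 2 ^ k * (real z / real d)\<bar> \<le> 1"
    by (simp add: right_diff_distrib)
  have "0 < d" by (simp add: d_def)
  then have "2 ^ k * z < Suc (2 ^ k * z div d) * d"
    by (metis add.commute dividend_less_div_times mult_Suc)
  then have "real (2 ^ k * z) < real (Suc (2 ^ k * z div d)) * real d"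
    by (metis of_nat_less_iff of_nat_mult)
  then have "2 ^ k * (real z / real d) < real (2 ^ k * z div d) + 1"
    using \<open>0 < d\<close> by (simp add: field_simps)
  moreover have "real (2 ^ k * z div d) \<le> 2 ^ k * (real z / real d)"
    using of_nat_div_le_of_nat[of "2 ^ k * z" d, where 'a = real] by simp
  ultimately show ?thesis
    using 1 unfolding q by linarith
qed

lemma recursive_nat_approx:
  "recursive a \<Longrightarrow> recursive b \<Longrightarrow> recursive (\<lambda>x. nat_approx (a x) (b x))"
  unfolding nat_approx_def by (intro recursive_intros)

lemma computable_real_nat_approx:
  assumes "computable_real x" and "0 \<le> x"
  obtains B where "recursive B" and "\<And>k. \<bar>2 ^ k * x - real (B k)\<bar> \<le> 2"
proof -
  obtain h where h: "recursive h" "\<And>k. \<bar>x - decode_rat (h k)\<bar> \<le> 1 / 2 ^ k"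
    using assms(1) unfolding computable_real_def by blast
  have "recursive (\<lambda>k. nat_approx k (h k))"
    by (intro recursive_nat_approx recursive_id h)
  with h(2) nat_approx[OF assms(2)] that show thesis by blast
qed

lemma computable_real_function_nat_approx:
  assumes "computable_real_function f" and "\<And>n. 0 \<le> f n"
  obtains A where "recursive2 A" and "\<And>n k. \<bar>2 ^ k * f n - real (A n k)\<bar> \<le> 2"
proof -
  obtain h where h: "recursive h"
    "\<And>n k. \<bar>f n - decode_rat (h (prod_encode (n, k)))\<bar> \<le> 1 / 2 ^ k"
    using assms(1) unfolding computable_real_function_def by blast
  have "recursive2 (\<lambda>n k. nat_approx k (h (prod_encode (n, k))))"
    unfolding recursive2_def
    by (intro recursive_nat_approx recursive_comp[OF h(1)] recursive_intros)
  with h(2) nat_approx[OF assms(2)] that show thesis by blast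
qed

lemma computable_real_function_comp:
  assumes "computable_real_function f" and "recursive a"
  shows "computable_real_function (\<lambda>n. f (a n))"
proof -
  obtain h where h: "recursive h"
    "\<And>n k. \<bar>f n - decode_rat (h (prod_encode (n, k)))\<bar> \<le> 1 / 2 ^ k"
    using assms(1) unfolding computable_real_function_def by blast
  have "recursive (\<lambda>y. h (prod_encode (a (arg1 y), arg2 y)))"
    by (intro recursive_comp[OF h(1)] recursive_comp[OF assms(2)] recursive_intros)
  with h(2) show ?thesis
    unfolding computable_real_function_def
    by (intro exI[of _ "\<lambda>y. h (prod_encode (a (arg1 y), arg2 y))"]) simp
qed

lemma computable_real_function_of_nat:
  assumes "recursive g"
  shows "computable_real_function (\<lambda>n. real (g n))"
  unfolding computable_real_function_def
proof (intro exI conjI allI)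
  show "recursive (\<lambda>y. prod_encode (2 * g (arg1 y), 0))"
    by (intro recursive_intros recursive_comp[OF assms])
  show "\<bar>real (g n) - decode_rat (prod_encode (2 * g (arg1 (prod_encode (n, k))), 0))\<bar> \<le> 1 / 2 ^ k"
    for n k
    by (simp add: decode_rat_def int_decode_def sum_decode_def)
qed

lemma of_nat_mult_power_diff:
  assumes "t \<le> m"
  shows "real (c * 2 ^ (m - t)) = 2 ^ m * (real c / 2 ^ t)"
proof -
  have "(2 :: real) ^ m = 2 ^ (m - t) * 2 ^ t"
    using assms by (simp flip: power_add)
  then show ?thesis
    by simp
qed

text \<open>Approximations to the sum and to the terms allow a search for a partial sum that is
  visibly close to the limit.\<close>

lemma tail_modulus:
  fixes a :: "nat \<Rightarrow> real"
  assumes a: "computable_real_function a" "\<And>n. 0 \<le> a n"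
    and summ: "summable (\<lambda>t. a t / 2 ^ t)" and S: "computable_real (\<Sum>t. a t / 2 ^ t)"
  obtains M where "recursive M"
    and "\<And>j. (\<Sum>t. a t / 2 ^ t) - (\<Sum>t<M j. a t / 2 ^ t) \<le> 13 / 2 ^ j"
proof -
  let ?S = "\<Sum>t. a t / 2 ^ t" and ?P = "\<lambda>M. \<Sum>t<M. a t / 2 ^ t"
  obtain A where A: "recursive2 A" "\<And>n k. \<bar>2 ^ k * a n - real (A n k)\<bar> \<le> 2"
    using computable_real_function_nat_approx[OF a] by blast
  have "0 \<le> ?S"
    by (intro suminf_nonneg summ) (simp add: a)
  then obtain B where B: "recursive B" "\<And>k. \<bar>2 ^ k * ?S - real (B k)\<bar> \<le> 2"
    using computable_real_nat_approx[OF S] by blast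
  \<comment> \<open>Scaling by \<open>2 ^ M\<close> makes the comparison one of natural numbers,
    hence decidable. The slack 7 is 2 for \<open>B\<close>, 4 for the sum over \<open>A\<close>, and
    1 for a partial sum near the limit; undoing both approximations turns 7 into 13.\<close>
  define test where "test j M \<longleftrightarrow>
    B j * 2 ^ M \<le> (\<Sum>t<M. A t j * 2 ^ (M - t)) + 7 * 2 ^ M" for j M
  have test: "test j M \<longleftrightarrow> real (B j) \<le> (\<Sum>t<M. A t j / 2 ^ t) + 7" for j M
  proof -
    have "real (\<Sum>t<M. A t j * 2 ^ (M - t)) = 2 ^ M * (\<Sum>t<M. A t j / 2 ^ t)"
      unfolding of_nat_sum sum_distrib_left by (intro sum.cong refl of_nat_mult_power_diff) simp
    then have "real ((\<Sum>t<M. A t j * 2 ^ (M - t)) + 7 * 2 ^ M) = 2 ^ M * ((\<Sum>t<M. A t j / 2 ^ t) + 7)"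
      by (simp add: algebra_simps)
    moreover have "real (B j * 2 ^ M) = 2 ^ M * real (B j)"
      by simp
    ultimately show ?thesis
      unfolding test_def of_nat_le_iff[where 'a = real, symmetric] by (simp del: of_nat_le_iff of_nat_add)
  qed
  have err: "\<bar>2 ^ j * ?P M - (\<Sum>t<M. A t j / 2 ^ t)\<bar> \<le> 4" for j M
  proof -
    have "2 ^ j * ?P M - (\<Sum>t<M. A t j / 2 ^ t) = (\<Sum>t<M. (2 ^ j * a t - A t j) / 2 ^ t)"
      by (simp add: sum_distrib_left sum_subtractf diff_divide_distrib)
    also have "\<bar>\<dots>\<bar> \<le> (\<Sum>t<M. 2 / 2 ^ t)"
      using A(2) by (intro order_trans[OF sum_abs] sum_mono) (simp add: divide_right_mono)
    also have "\<dots> = 4 - 4 / 2 ^ M"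
      by (induction M) (simp_all add: field_simps)
    also have "\<dots> \<le> 4" by simp
    finally show ?thesis .
  qed
  have ex: "\<exists>M. test j M" for j
  proof -
    have "?P \<longlonglongrightarrow> ?S"
      using summ by (rule summable_LIMSEQ)
    then have "\<forall>\<^sub>F M in sequentially. ?S - 1 / 2 ^ j < ?P M"
      by (rule order_tendstoD) simp
    then obtain M where "?S - 1 / 2 ^ j < ?P M"
      by (meson eventually_happens trivial_limit_sequentially)
    then have "2 ^ j * ?S - 1 < 2 ^ j * ?P M"
      by (simp add: field_simps)
    then have "test j M"
      unfolding test using err[of j M] B(2)[of j] by linarith
    then show ?thesis by blast
  qed
  define M where "M j = (LEAST M. test j M)" for j
  have "recursive M"
    unfolding M_def using ex unfolding test_def
    by (intro recursive_Least recursive_intros recursive_comp[OF B(1)] recursive_comp2[OF A(1)]) auto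
  moreover have "?S - ?P (M j) \<le> 13 / 2 ^ j" for j
  proof -
    have "test j (M j)"
      unfolding M_def by (rule LeastI_ex[OF ex])
    then have "2 ^ j * ?S - 2 ^ j * ?P (M j) \<le> 13"
      unfolding test using err[of j "M j"] B(2)[of j] by linarith
    then show ?thesis
      by (simp add: field_simps)
  qed
  ultimately show thesis using that by blast
qed

lemma nat_majorant:
  fixes b :: "nat \<Rightarrow> real"
  assumes b: "computable_real_function b" "mono b" "\<And>n. 0 \<le> b n"
  obtains h where "recursive h" and "strict_mono h"
    and "\<And>m. b m + 2 * real m \<le> real (h m)" and "\<And>m. real (h m) \<le> b m + 5 * real m + 7"
proof -
  obtain A where A: "recursive2 A" "\<And>n k. \<bar>2 ^ k * b n - real (A n k)\<bar> \<le> 2"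
    using computable_real_function_nat_approx[OF b(1,3)] by blast
  \<comment> \<open>\<open>A m 0\<close> is within 2 of \<open>b m\<close>, so it can drop by at
    most 4 from one \<open>m\<close> to the next; the slope 5 restores strict growth.\<close>
  define h where "h m = A m 0 + 5 * m + 5" for m
  have A0: "\<bar>b m - real (A m 0)\<bar> \<le> 2" for m
    using A(2)[where k = 0] by simp
  have "recursive h"
    unfolding h_def by (intro recursive_intros recursive_comp2[OF A(1)])
  moreover have "strict_mono h"
    unfolding strict_mono_Suc_iff
  proof
    fix m
    have "real (h m) < real (h (Suc m))"
      using A0[of m] A0[of "Suc m"] monoD[OF b(2), of m "Suc m"] by (simp add: h_def)
    then show "h m < h (Suc m)" by simp
  qed
  moreover have "b m + 2 * real m \<le> real (h m)" "real (h m) \<le> b m + 5 * real m + 7" for m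
    using A0[of m] by (simp_all add: h_def)
  ultimately show thesis using that by blast
qed

text \<open>Telescoping: each summand is the difference of
  \<open>(2 * a * m + 2 * (a + b)) / 2 ^ m\<close> at \<open>m\<close> and at
  \<open>m + 1\<close>.\<close>

lemma sum_linear_geometric:
  fixes a b :: real
  assumes "j \<le> N"
  shows "(\<Sum>m\<in>{j..<N}. (a * real m + b) / 2 ^ m) =
    (2 * a * real j + 2 * (a + b)) / 2 ^ j - (2 * a * real N + 2 * (a + b)) / 2 ^ N"
  using assms
proof (induction N rule: dec_induct)
  case (step N)
  then have "(\<Sum>m\<in>{j..<Suc N}. (a * real m + b) / 2 ^ m) =
      (\<Sum>m\<in>{j..<N}. (a * real m + b) / 2 ^ m) + (a * real N + b) / 2 ^ N"
    by simp
  also have "(a * real N + b) / 2 ^ N =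
      (2 * a * real N + 2 * (a + b)) / 2 ^ N - (2 * a * real (Suc N) + 2 * (a + b)) / 2 ^ Suc N"
    by (simp add: field_simps)
  finally show ?case using step.IH by simp
qed simp

lemma load_le:
  assumes "(\<Sum>l<Suc m. real (F l) / 2 ^ l) \<le> 1"
  shows "load F m \<le> 2 ^ m"
proof -
  have "real (load F m) = 2 ^ m * (\<Sum>l<Suc m. real (F l) / 2 ^ l)"
    unfolding load_def of_nat_sum sum_distrib_left
    by (intro sum.cong refl of_nat_mult_power_diff) simp
  also have "\<dots> \<le> 2 ^ m * 1"
    by (intro mult_left_mono assms) simp
  finally have "real (load F m) \<le> real (2 ^ m)"
    by simp
  then show ?thesis
    by (simp only: of_nat_le_iff)
qed

text \<open>\<open>F\<close> is \<open>h\<close> times a slowly growing unbounded factor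
  \<open>u\<close>, and \<open>g\<close> is \<open>h\<close> composed with an inverse of
  \<open>F\<close>. The factor is what makes \<open>g n / n\<close> vanish, and the tail bounds pay
  for it.\<close>

lemma ex_capacity:
  assumes h: "recursive h" "strict_mono h" and M: "recursive M"
    and tail: "\<And>j N. (\<Sum>m | m < N \<and> j \<le> m \<and> M j \<le> m. real (h m) / 2 ^ m)
      \<le> (10 * real j + 76) / 2 ^ j"
  obtains F g where "recursive F" "recursive g" "mono g" "\<And>m. load F m \<le> 2 ^ m"
    "\<And>m. h m \<le> g (F m)" "(\<lambda>n. real (g n) / real n) \<longlonglongrightarrow> 0"
proof -
  \<comment> \<open>The \<open>j\<close>-th tail contributes at most \<open>(10 j + 76) / 2 ^ j\<close> to \<open>\<Sum>m. u m * h m / 2 ^ m\<close>; starting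
    at \<open>j = 9\<close> keeps the total at most 1.\<close>
  define u where "u m = (\<Sum>j<Suc m. of_bool (9 \<le> j \<and> M j \<le> m) :: nat)" for m
  define F where "F m = u m * h m" for m
  have rec_u: "recursive u"
    unfolding u_def by (intro recursive_intros recursive_comp[OF M])
  have rec_F: "recursive F"
    unfolding F_def by (intro recursive_mult rec_u h)
  have mono_u: "u m \<le> u n" if "m \<le> n" for m n
    unfolding u_def using that
    by (intro order_trans[OF sum_mono sum_mono2]) auto
  have mono_h: "h m \<le> h n" if "m \<le> n" for m n
    using h(2) that by (simp add: strict_mono_less_eq)
  have mono_F: "F m \<le> F n" if "m \<le> n" for m n
    unfolding F_def using that by (intro mult_le_mono mono_u mono_h)
  have unbounded_u: "\<exists>m. N \<le> u m" for N
  proof -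
    \<comment> \<open>Large enough for all \<open>N\<close> indices from 9 to \<open>8 + N\<close>
      to be counted in \<open>u m\<close>.\<close>
    define m where "m = 9 + N + (\<Sum>j<9 + N. M j)"
    have "M j \<le> m" if "j < 9 + N" for j
      using that member_le_sum[of j "{..<9 + N}" M] by (simp add: m_def)
    then have "(\<Sum>j\<in>{9..<9 + N}. 1) \<le> (\<Sum>j\<in>{9..<9 + N}. of_bool (9 \<le> j \<and> M j \<le> m) :: nat)"
      by (intro sum_mono) auto
    also have "\<dots> \<le> u m"
      unfolding u_def by (intro sum_mono2) (auto simp: m_def)
    finally show ?thesis by auto
  qed
  have "(\<Sum>m<N. real (F m) / 2 ^ m) \<le> 1" for N
  proof -
    let ?w = "\<lambda>m. real (h m) / 2 ^ m"
    have "real (F m) / 2 ^ m = (\<Sum>j<N. of_bool (9 \<le> j \<and> j \<le> m \<and> M j \<le> m) * ?w m)" if "m < N" for m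
    proof -
      have "real (u m) = (\<Sum>j<N. of_bool (9 \<le> j \<and> j \<le> m \<and> M j \<le> m))"
        unfolding u_def of_nat_sum using that
        by (intro sum.mono_neutral_cong_left) auto
      then show ?thesis
        unfolding F_def of_nat_mult times_divide_eq_right[symmetric]
        by (simp only: sum_distrib_right)
    qed
    then have "(\<Sum>m<N. real (F m) / 2 ^ m) =
        (\<Sum>m<N. \<Sum>j<N. of_bool (9 \<le> j \<and> j \<le> m \<and> M j \<le> m) * ?w m)"
      by (intro sum.cong) auto
    \<comment> \<open>After the interchange each \<open>j\<close> contributes one tail of the series
      of \<open>h m / 2 ^ m\<close>.\<close>
    also have "\<dots> = (\<Sum>j<N. \<Sum>m<N. of_bool (9 \<le> j \<and> j \<le> m \<and> M j \<le> m) * ?w m)"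
      by (rule sum.swap)
    also have "\<dots> = (\<Sum>j<N. of_bool (9 \<le> j) * (\<Sum>m | m < N \<and> j \<le> m \<and> M j \<le> m. ?w m))"
      unfolding sum_distrib_left
      by (intro sum.cong sum.mono_neutral_cong_right) auto
    also have "\<dots> \<le> (\<Sum>j<N. of_bool (9 \<le> j) * ((10 * real j + 76) / 2 ^ j))"
      by (intro sum_mono mult_left_mono tail) auto
    also have "\<dots> \<le> (\<Sum>j<9 + N. of_bool (9 \<le> j) * ((10 * real j + 76) / 2 ^ j))"
      by (intro sum_mono2) auto
    also have "\<dots> = (\<Sum>j\<in>{9..<9 + N}. (10 * real j + 76) / 2 ^ j)"
      by (intro sum.mono_neutral_cong_right) auto
    \<comment> \<open>\<open>352 / 2 ^ 9 = 11 / 16\<close>; starting at 8 would give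
      \<open>332 / 2 ^ 8\<close>, which exceeds 1.\<close>
    also have "\<dots> = 11 / 16 - (352 + 20 * real N) / 2 ^ (9 + N)"
      by (simp add: sum_linear_geometric)
    also have "\<dots> \<le> 11 / 16 - 0"
      by (intro diff_left_mono divide_nonneg_nonneg) auto
    also have "\<dots> \<le> (1 :: real)"
      by simp
    finally show ?thesis .
  qed
  then have load: "load F m \<le> 2 ^ m" for m
    by (rule load_le)
  have unbounded_F: "\<exists>p. n < F p" for n
  proof -
    obtain m where m: "1 \<le> u m" using unbounded_u by blast
    let ?p = "max m (Suc n)"
    have "n < h ?p"
      using strict_mono_imp_increasing[OF h(2), of ?p] by linarith
    also have "h ?p \<le> F ?p"
      using mono_u[of m ?p] m by (simp add: F_def)
    finally show ?thesis by blast
  qed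
  \<comment> \<open>\<open>p n - 1\<close> is the last level with capacity at most \<open>n\<close>;
    it exists because \<open>u 0 = 0\<close> gives \<open>F 0 = 0\<close>.\<close>
  define p where "p n = (LEAST p. n < F p)" for n
  define g where "g n = h (p n - 1)" for n
  have p: "n < F (p n)" for n
    unfolding p_def by (rule LeastI_ex[OF unbounded_F])
  have p_le: "p n \<le> k" if "n < F k" for n k
    unfolding p_def using that by (rule Least_le)
  have less_p: "m < p n" if "F m \<le> n" for m n
    using that p[of n] mono_F[of "p n" m] by (meson leD le_trans not_le)
  have p_pos: "0 < p n" for n
    by (rule less_p) (simp add: F_def u_def)
  have p_pred: "F (p n - 1) \<le> n" for n
    using p_le[of n "p n - 1"] p_pos[of n] by fastforce
  have "recursive p"
    unfolding p_def
    by (intro recursive_Least recursive_intros recursive_comp[OF rec_F] unbounded_F)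
  then have "recursive g"
    unfolding g_def by (intro recursive_comp[OF h(1)] recursive_pred)
  moreover have "mono g"
  proof (rule monoI)
    fix m n :: nat assume "m \<le> n"
    then have "p m \<le> p n"
      using p_le p le_less_trans by blast
    then show "g m \<le> g n"
      unfolding g_def by (intro mono_h diff_le_mono)
  qed
  moreover have "h m \<le> g (F m)" for m
    unfolding g_def using less_p[of m "F m"] by (intro mono_h) simp
  moreover have "(\<lambda>n. real (g n) / real n) \<longlonglongrightarrow> 0"
  proof (rule LIMSEQ_I)
    fix e :: real assume "0 < e"
    then obtain N where N: "0 < N" "1 / real N < e"
      by (metis real_arch_inverse inverse_eq_divide gr0I)
    obtain m where m: "N \<le> u m" using unbounded_u by blast
    have "norm (real (g n) / real n - 0) < e" if n: "Suc (F m) \<le> n" for n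
    proof -
      have "m \<le> p n - 1"
        using less_p[of m n] n by simp
      \<comment> \<open>For levels from \<open>m\<close> on, the factor \<open>u\<close> is at least
        \<open>N\<close>, so \<open>N * g n\<close> is at most a capacity that is itself at most
        \<open>n\<close>.\<close>
      then have "N * g n \<le> F (p n - 1)"
        unfolding F_def g_def using m mono_u by (intro mult_le_mono1) (meson order_trans)
      also note p_pred
      finally have "real N * real (g n) \<le> real n"
        by (metis of_nat_le_iff of_nat_mult)
      then have "real (g n) / real n \<le> 1 / real N"
        using N(1) n by (simp add: field_simps)
      with N(2) show ?thesis by simp
    qed
    then show "\<exists>n0. \<forall>n\<ge>n0. norm (real (g n) / real n - 0) < e" by blast
  qed
  ultimately show thesis
    using that rec_F load by blast
qed

section \<open>The reduction\<close>

lemma ex_capacity_real: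
  fixes f :: "nat \<Rightarrow> real"
  assumes f: "\<And>n. 0 \<le> f n" "computable_real_function f" "mono f"
    and summ: "summable (\<lambda>m. f (2 ^ m) / 2 ^ m)"
    and S: "computable_real (\<Sum>m. f (2 ^ m) / 2 ^ m)"
  obtains F g where "recursive F" "recursive g" "mono g" "\<And>m. load F m \<le> 2 ^ m"
    "\<And>m. f (2 ^ (m + 2)) + 2 * real m \<le> real (g (F m))" "(\<lambda>n. real (g n) / real n) \<longlonglongrightarrow> 0"
proof -
  let ?w = "\<lambda>t. f (2 ^ t) / 2 ^ t"
  have comp: "computable_real_function (\<lambda>t. f (2 ^ t))"
    "computable_real_function (\<lambda>m. f (2 ^ (m + 2)))"
    by (intro computable_real_function_comp[OF f(2)] recursive_intros)+
  obtain M where M: "recursive M" "\<And>j. suminf ?w - (\<Sum>t<M j. ?w t) \<le> 13 / 2 ^ j"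
    using tail_modulus[OF comp(1) _ summ S] f(1) by blast
  have "mono (\<lambda>m. f (2 ^ (m + 2)))"
    by (intro monoI monoD[OF f(3)] power_increasing) auto
  from nat_majorant[OF comp(2) this] f(1) obtain h where h: "recursive h" "strict_mono h"
    "\<And>m. f (2 ^ (m + 2)) + 2 * real m \<le> real (h m)"
    "\<And>m. real (h m) \<le> f (2 ^ (m + 2)) + 5 * real m + 7"
    by blast
  \<comment> \<open>The 76 is \<open>4 * 13 + 24\<close>: four times the tail of the given series,
    the 4 being due to the index shift by 2, plus the constant from the linear part
    \<open>5 * m + 7\<close> of the majorant.\<close>
  have "(\<Sum>m | m < N \<and> j \<le> m \<and> M j \<le> m. real (h m) / 2 ^ m) \<le> (10 * real j + 76) / 2 ^ j"
    for j N
  proof -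
    let ?T = "{m. m < N \<and> j \<le> m \<and> M j \<le> m}"
    have fin: "finite ?T" by simp
    have "(\<Sum>m\<in>?T. real (h m) / 2 ^ m) \<le> (\<Sum>m\<in>?T. 4 * ?w (m + 2) + (5 * real m + 7) / 2 ^ m)"
    proof (rule sum_mono)
      fix m
      have "4 * ?w (m + 2) + (5 * real m + 7) / 2 ^ m = (f (2 ^ (m + 2)) + 5 * real m + 7) / 2 ^ m"
        by (simp add: add_divide_distrib)
      then show "real (h m) / 2 ^ m \<le> 4 * ?w (m + 2) + (5 * real m + 7) / 2 ^ m"
        using h(4)[of m] by (simp only: divide_right_mono zero_le_power zero_le_numeral)
    qed
    also have "\<dots> = 4 * (\<Sum>m\<in>?T. ?w (m + 2)) + (\<Sum>m\<in>?T. (5 * real m + 7) / 2 ^ m)"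
      by (simp only: sum.distrib sum_distrib_left)
    finally have split: "(\<Sum>m\<in>?T. real (h m) / 2 ^ m) \<le> \<dots>" .
    have "(\<Sum>m\<in>?T. ?w (m + 2)) = (\<Sum>t\<in>(\<lambda>m. m + 2) ` ?T. ?w t)"
      by (subst sum.reindex) (simp_all add: comp_def inj_on_def)
    \<comment> \<open>The shifted indices lie beyond \<open>M j\<close>, so together with the
      partial sum they stay below the full sum.\<close>
    then have "(\<Sum>m\<in>?T. ?w (m + 2)) + (\<Sum>t<M j. ?w t) =
        (\<Sum>t\<in>(\<lambda>m. m + 2) ` ?T \<union> {..<M j}. ?w t)"
      using fin by (subst sum.union_disjoint) auto
    also have "\<dots> \<le> suminf ?w"
      using fin f(1) by (intro sum_le_suminf summ) auto
    finally have 1: "(\<Sum>m\<in>?T. ?w (m + 2)) \<le> 13 / 2 ^ j"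
      using M(2)[of j] by linarith
    have "(\<Sum>m\<in>?T. (5 * real m + 7) / 2 ^ m) \<le> (\<Sum>m\<in>{j..<max j N}. (5 * real m + 7) / 2 ^ m)"
      by (intro sum_mono2) auto
    also have "\<dots> = (10 * real j + 24) / 2 ^ j - (10 * real (max j N) + 24) / 2 ^ max j N"
      by (simp add: sum_linear_geometric)
    also have "\<dots> \<le> (10 * real j + 24) / 2 ^ j - 0"
      by (intro diff_left_mono divide_nonneg_nonneg) auto
    finally have 2: "(\<Sum>m\<in>?T. (5 * real m + 7) / 2 ^ m) \<le> (10 * real j + 24) / 2 ^ j"
      by simp
    have "(10 * real j + 76) / 2 ^ j = 4 * (13 / 2 ^ j) + (10 * real j + 24) / 2 ^ j"
      by (simp add: add_divide_distrib)
    with split 1 2 show ?thesis by linarith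
  qed
  from ex_capacity[OF h(1,2) M(1) this] obtain F g where Fg: "recursive F" "recursive g" "mono g"
    "\<And>m. load F m \<le> 2 ^ m" "\<And>m. h m \<le> g (F m)" "(\<lambda>n. real (g n) / real n) \<longlonglongrightarrow> 0"
    by blast
  have "f (2 ^ (m + 2)) + 2 * real m \<le> real (g (F m))" for m
    using h(3)[of m] Fg(5)[of m] by linarith
  with Fg that show thesis by blast
qed

text \<open>For window lengths from \<open>2 ^ (m + 1)\<close> up to \<open>2 ^ (m + 2)\<close>, the
  term \<open>2 * m\<close> in the hypothesis on \<open>g\<close> pays for the header, and
  monotonicity of \<open>f\<close> covers the whole range of lengths.\<close>

lemma SC_reducible_COMPLEX:
  assumes U: "universal_machine U" and F: "recursive F" "\<And>m. load F m \<le> 2 ^ m"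
    and f: "mono f" and g: "\<And>m. f (2 ^ (m + 2)) + 2 * real m \<le> g (F m)"
  shows "to_baire ` SC U f \<le>\<^sub>s to_baire ` COMPLEX U g"
proof -
  obtain c where c: "\<And>(X :: nat \<Rightarrow> bool) i n m. 2 ^ Suc m \<le> n \<Longrightarrow>
      K U (map X [0..<F m]) \<le> K U (map (X \<circ> source F) [i..<i + n]) + 2 * m + c"
    using K_window[OF U F] by blast
  have SC: "X \<circ> source F \<in> SC U f" if X: "X \<in> COMPLEX U g" for X
  proof -
    obtain d :: nat where d: "\<And>n. g n - d \<le> K U (map X [0..<n])"
      using X by (auto simp: COMPLEX_def)
    \<comment> \<open>The last summand handles strings of length 0 and 1, which are too short to
      decode.\<close>
    define e where "e = c + d + nat \<lceil>f 1\<rceil>"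
    have "f (length \<tau>) - e \<le> K U \<tau>" if \<tau>: "substring \<tau> (X \<circ> source F)" for \<tau>
    proof (cases "length \<tau> < 2")
      case True
      then have "f (length \<tau>) \<le> f 1"
        by (intro monoD[OF f]) simp
      also have "f 1 \<le> nat \<lceil>f 1\<rceil>"
        by (rule real_nat_ceiling_ge)
      finally show ?thesis
        by (simp add: e_def)
    next
      case False
      then obtain m' where m': "2 ^ m' \<le> length \<tau>" "length \<tau> < 2 ^ Suc m'"
        using ex_power_ivl1[of 2 "length \<tau>"] by auto
      with False obtain m where m: "m' = Suc m"
        by (cases m') auto
      obtain i where i: "\<tau> = map (X \<circ> source F) [i..<i + length \<tau>]"
        using \<tau> unfolding substring_def by blast
      have "f (length \<tau>) \<le> f (2 ^ (m + 2))"
        using m' m by (intro monoD[OF f]) simp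
      moreover have "K U (map X [0..<F m]) \<le> K U \<tau> + 2 * m + c"
        using c[of m "length \<tau>" X i] m' m i by metis
      ultimately show ?thesis
        using g[of m] d[of "F m"] by (simp add: e_def)
    qed
    then show ?thesis
      unfolding SC_def by blast
  qed
  obtain p where p: "\<And>X n. run X p n = Some (source F n)"
    using recursive_source[OF F(1)] by (meson recursiveE)
  show ?thesis
    unfolding strongly_reducible_def
  proof (intro exI conjI ballI)
    \<comment> \<open>Bit \<open>n\<close> of the output is a single query to the oracle, at
      \<open>source F n\<close>.\<close>
    show "partial_recursive_functional (\<lambda>X. run X (Comp Query p))"
      unfolding partial_recursive_functional_def by blast
    fix X assume "X \<in> to_baire ` COMPLEX U g"
    then obtain Z where Z: "X = to_baire Z" "Z \<in> COMPLEX U g" by blast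
    show "\<exists>Y\<in>to_baire ` SC U f. \<forall>n. run X (Comp Query p) n = Some (Y n)"
      by (intro bexI[OF _ imageI[OF SC[OF Z(2)]]]) (simp add: p Z(1) to_baire_def)
  qed
qed

theorem mainTheorem5:
  fixes U :: "bool list \<Rightarrow> bool list option" and f :: "nat \<Rightarrow> real"
  assumes "universal_machine U"
    and "\<And>n. 0 \<le> f n"
    and "order_function f"
    and "sub_identical f"
    and "summable (\<lambda>m. f (2 ^ m) / 2 ^ m)"
    and "computable_real (\<Sum>m. f (2 ^ m) / 2 ^ m)"
  shows "\<exists>g :: nat \<Rightarrow> real.
           (\<forall>n. 0 \<le> g n) \<and> order_function g \<and>
           to_baire ` SC U f \<le>\<^sub>s to_baire ` COMPLEX U g \<and>
           (\<lambda>n. g n / real n) \<longlonglongrightarrow> 0"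
proof -
  have f: "computable_real_function f" "mono f"
    using assms(3) by (simp_all add: order_function_def)
  obtain F g where Fg: "recursive F" "recursive g" "mono g" "\<And>m. load F m \<le> 2 ^ m"
    "\<And>m. f (2 ^ (m + 2)) + 2 * real m \<le> real (g (F m))" "(\<lambda>n. real (g n) / real n) \<longlonglongrightarrow> 0"
    using ex_capacity_real[OF assms(2) f assms(5,6)] by blast
  \<comment> \<open>\<open>g (F m)\<close> is at least \<open>2 * m\<close>, because
    \<open>f\<close> is nonnegative.\<close>
  have "\<not> bdd_above (range (\<lambda>n. real (g n)))"
  proof
    assume "bdd_above (range (\<lambda>n. real (g n)))"
    then obtain B where B: "\<And>n. real (g n) \<le> B"
      by (auto simp: bdd_above_def)
    obtain m where "B < real m"
      using reals_Archimedean2 by blast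
    then show False
      using B[of "F m"] Fg(5)[of m] assms(2)[of "2 ^ (m + 2)"] by linarith
  qed
  then have "order_function (\<lambda>n. real (g n))"
    using computable_real_function_of_nat[OF Fg(2)] Fg(3)
    by (simp add: order_function_def mono_def)
  moreover have "to_baire ` SC U f \<le>\<^sub>s to_baire ` COMPLEX U (\<lambda>n. real (g n))"
    by (rule SC_reducible_COMPLEX[OF assms(1) Fg(1,4) f(2) Fg(5)])
  ultimately show ?thesis
    using Fg(6) by (intro exI[of _ "\<lambda>n. real (g n)"]) simp
qed

end
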